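(* Let $m,n,G,T\ge 1$ be integers and let $\varrho>0$. For $s\in[T]$ let $\Psi(s)\in\mathbb{C}^{m\times n}$ satisfy $\Psi(s)\Psi(s)^\dagger=I_m$, let $A\in\mathbb{C}^{n\times G}$ be the dictionary matrix, and let $x(s)=\Psi(s)h(s)+z(s)\in\mathbb{C}^m$, $s\in[T]$, be the noisy sketches of the signal samples $h(s)\in\mathbb{C}^n$ (setting described in the context). Define, for $C=[c(1),\dots,c(T)]\in\mathbb{C}^{G\times T}$, $$f(C)=\frac12\sum_{s\in[T]}\|x(s)-\Psi(s)A\,c(s)\|_2^2+\varrho\sqrt{T}\,\|C\|_{2,1},$$ and, for $\gamma=(\gamma_1,\dots,\gamma_G)^{\mathsf T}\in\mathbb{R}_+^G$ with $\Gamma=\mathrm{diag}(\gamma)$, $$g(\gamma)=\frac1T\sum_{s\in[T]}x(s)^\dagger\big(\Psi(s)A\Gamma A^\dagger\Psi(s)^\dagger+\varrho I_m\big)^{-1}x(s)+\mathrm{tr}(\Gamma).$$ Let $\widehat C=\arg\min_{C\in\mathbb{C}^{G\times T}}f(C)$ and $\widehat\gamma=\arg\min_{\gamma\in\mathbb{R}_+^G}g(\gamma)$ be the optimal solutions of the convex functions $f$ and $g$, respectively. Then $$\widehat\gamma_i=\frac{\|\widehat C_{i,:}\|_2}{\sqrt T}\qquad\text{for } i\in[G].$$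
   Context: Notation: $[N]=\{1,\dots,N\}$; $\dagger$ is conjugate transpose; $I_m$ is the $m\times m$ identity; $\mathbb{R}_+=[0,\infty)$; $\mathrm{tr}$ is the trace; $C_{i,:}$ is the $i$-th row of $C$ and $c(s)$ its $s$-th column; $\|C\|_{2,1}=\sum_{i\in[G]}\|C_{i,:}\|_2$; $\mathrm{diag}(\gamma)$ is the $G\times G$ diagonal matrix with diagonal entries $\gamma_1,\dots,\gamma_G$. Setting: $\{a(\xi):\xi\in\Xi\}\subset\mathbb{C}^n$ is a dictionary of atoms labelled by a finite or infinite set $\Xi$. The signal samples share a common support $\{\xi_1,\dots,\xi_k\}\subset\Xi$: $h(s)=\sum_{i=1}^k w_i(s)a(\xi_i)$ with (random) coefficients $w_i(s)\in\mathbb{C}$, $s\in[T]$. The sketches are $x(s)=\Psi(s)h(s)+z(s)$ with noise $z(s)\in\mathbb{C}^m$. The dictionary matrix is $A=[a(\xi_1^\circ),\dots,a(\xi_G^\circ)]\in\mathbb{C}^{n\times G}$ for a finite grid $\{\xi_1^\circ,\dots,\xi_G^\circ\}$, which need not contain the true support. *)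

theory Defs
  imports "HOL-Analysis.Analysis"
begin

text \<open>
  A complex \<open>p\<close> by \<open>q\<close> matrix has type \<open>complex ^ 'q ^ 'p\<close> (rows outermost), and \<open>norm\<close> on
  \<open>complex ^ 'p\<close> is the Euclidean norm. In all that follows the sizes \<open>m\<close>, \<open>n\<close>, \<open>G\<close>, \<open>T\<close> are
  the cardinalities of the index types \<open>'m\<close>, \<open>'n\<close>, \<open>'g\<close>, \<open>'t\<close>.
\<close>

definition conj_transpose :: "complex ^ 'q ^ 'p \<Rightarrow> complex ^ 'p ^ 'q"  ("(_\<^sup>\<dagger>)" [1000] 999)
  where "M\<^sup>\<dagger> = (\<chi> i j. cnj (M $ j $ i))"

text \<open>The sesquilinear form \<open>x\<^sup>\<dagger> M x\<close>.\<close>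

definition sesq_form :: "complex ^ 'p ^ 'p \<Rightarrow> complex ^ 'p \<Rightarrow> complex"
  where "sesq_form M x = (\<Sum>i\<in>UNIV. cnj (x $ i) * (M *v x) $ i)"

definition norm21 :: "complex ^ 't ^ 'g \<Rightarrow> real"
  where "norm21 C = (\<Sum>i\<in>UNIV. norm (row i C))"

definition diag_mat :: "real ^ 'g \<Rightarrow> complex ^ 'g ^ 'g"
  where "diag_mat \<gamma> = (\<chi> i j. if i = j then complex_of_real (\<gamma> $ i) else 0)"

definition nonneg_orthant :: "(real ^ 'g) set"
  where "nonneg_orthant = {\<gamma>. \<forall>i. 0 \<le> \<gamma> $ i}"

definition f_obj ::
  "('t \<Rightarrow> complex ^ 'n ^ 'm) \<Rightarrow> complex ^ 'g ^ 'n \<Rightarrow> ('t \<Rightarrow> complex ^ 'm) \<Rightarrow> real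
    \<Rightarrow> complex ^ 't ^ 'g \<Rightarrow> real"
  where "f_obj \<Psi> A x \<rho> C =
    1 / 2 * (\<Sum>s\<in>UNIV. (norm (x s - (\<Psi> s ** A) *v column s C))\<^sup>2)
    + \<rho> * sqrt (real CARD('t)) * norm21 C"

text \<open>
  For \<open>\<gamma>\<close> in the orthant and \<open>\<rho> > 0\<close> the matrix being inverted is Hermitian positive definite,
  so it is invertible and both arguments of \<open>Re\<close> below are real; \<open>Re\<close> only changes the type.
\<close>

definition g_obj ::
  "('t \<Rightarrow> complex ^ 'n ^ 'm) \<Rightarrow> complex ^ 'g ^ 'n \<Rightarrow> ('t \<Rightarrow> complex ^ 'm) \<Rightarrow> real
    \<Rightarrow> real ^ 'g \<Rightarrow> real"
  where "g_obj \<Psi> A x \<rho> \<gamma> =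
    1 / real CARD('t) *
      (\<Sum>s\<in>UNIV. Re (sesq_form
        (matrix_inv (\<Psi> s ** A ** diag_mat \<gamma> ** A\<^sup>\<dagger> ** (\<Psi> s)\<^sup>\<dagger> + \<rho> *\<^sub>R mat 1)) (x s)))
    + Re (trace (diag_mat \<gamma>))"

end

theory Submission
  imports Defs
begin

text \<open>
  With \<open>B s = \<Psi> s ** A\<close> consider the joint objective
  \[ J(C,\gamma) = \sum_s \Bigl(\frac1\varrho \|x(s) - B(s) c(s)\|^2
       + \sum_i \frac{|C_{i,s}|^2}{\gamma_i}\Bigr) + T \sum_i \gamma_i, \]
  where \<open>C\<close> has zero rows where \<open>\<gamma>\<close> vanishes. Minimizing over \<open>C\<close> gives \<open>T g(\<gamma>)\<close>, by
  Lagrange duality for a ridge regression; minimizing over \<open>\<gamma>\<close> gives \<open>(2/\<rho>) f(C)\<close>, by AM-GM with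
  equality exactly at the asserted \<open>\<gamma>\<close>. Hence the minimizers correspond. The dual form of the
  regression also shows that \<open>g\<close> is a supremum of affine functions of \<open>\<gamma>\<close>, hence convex.
\<close>

section \<open>Ridge regression and its dual\<close>

text \<open>On complex vectors \<open>\<bullet>\<close> is the real part of the Hermitian form.
  Moving a factor to the other side therefore conjugates it, entry by entry.\<close>

lemma inner_matrix_vector_adjoint:
  fixes B :: "complex ^ 'g ^ 'm"
  shows "(B *v c) \<bullet> y = c \<bullet> (B\<^sup>\<dagger> *v y)"
proof -
  have "(B *v c) \<bullet> y = (\<Sum>i\<in>UNIV. \<Sum>j\<in>UNIV. (B $ i $ j * c $ j) \<bullet> (y $ i))"
    by (simp add: inner_vec_def matrix_vector_mult_def inner_sum_left)
  also have "\<dots> = (\<Sum>j\<in>UNIV. \<Sum>i\<in>UNIV. (B $ i $ j * c $ j) \<bullet> (y $ i))"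
    by (rule sum.swap)
  also have "\<dots> = (\<Sum>j\<in>UNIV. \<Sum>i\<in>UNIV. (c $ j) \<bullet> (cnj (B $ i $ j) * y $ i))"
    by (intro sum.cong refl) (simp add: inner_complex_def algebra_simps)
  also have "\<dots> = c \<bullet> (B\<^sup>\<dagger> *v y)"
    by (simp add: inner_vec_def matrix_vector_mult_def inner_sum_right conj_transpose_def)
  finally show ?thesis .
qed

lemma conj_transpose_mult:
  fixes P :: "complex ^ 'n ^ 'm" and Q :: "complex ^ 'g ^ 'n"
  shows "(P ** Q)\<^sup>\<dagger> = Q\<^sup>\<dagger> ** P\<^sup>\<dagger>"
  by (simp add: conj_transpose_def matrix_matrix_mult_def vec_eq_iff mult.commute)

text \<open>Passes from the form in \<open>g_obj\<close> to the real inner product in which the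
  duality is carried out. It holds for every \<open>M\<close>, so the inverse need not be shown
  Hermitian.\<close>

lemma Re_sesq_form: "Re (sesq_form M x) = x \<bullet> (M *v x)"
  by (simp add: sesq_form_def inner_vec_def inner_complex_def)

lemma diag_mat_mult_nth: "(diag_mat \<gamma> *v u) $ i = \<gamma> $ i *\<^sub>R (u $ i)"
  by (simp add: diag_mat_def matrix_vector_mult_def if_distrib[of "\<lambda>x. x * _"]
      scaleR_conv_of_real cong: if_cong)

lemma scaleR_mat_1_mult: "((r *\<^sub>R mat 1) :: complex ^ 'm ^ 'm) *v y = r *\<^sub>R y"
  by (simp add: vec_eq_iff mat_def matrix_vector_mult_def if_distrib[of "\<lambda>x. x * _"]
      if_distrib[of "\<lambda>x. _ *\<^sub>R x"] cong: if_cong)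

text \<open>Expand the square of \<open>norm (r *\<^sub>R u - c)\<close> and divide by
  \<open>r\<close>. For \<open>r = 0\<close> the quotient is 0 by convention, and
  \<open>c = 0\<close> makes both sides vanish.\<close>

lemma weighted_Young:
  fixes u c :: "'a :: real_inner"
  assumes "r \<ge> 0" "r = 0 \<Longrightarrow> c = 0"
  shows "2 * (u \<bullet> c) \<le> r * (norm u)\<^sup>2 + (norm c)\<^sup>2 / r"
proof (cases "r = 0")
  case False
  then have r: "r > 0" using assms by simp
  have "0 \<le> (norm (r *\<^sub>R u - c))\<^sup>2 / r" using r by simp
  also have "\<dots> = r * (norm u)\<^sup>2 + (norm c)\<^sup>2 / r - 2 * (u \<bullet> c)"
    using r unfolding power2_norm_eq_inner
    by (simp add: inner_diff_left inner_diff_right inner_commute field_simps power2_eq_square)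
  finally show ?thesis by simp
qed (use assms in simp)

definition regularized_gram :: "complex ^ 'g ^ 'm \<Rightarrow> real \<Rightarrow> real ^ 'g \<Rightarrow> complex ^ 'm ^ 'm"
  where "regularized_gram B \<rho> \<gamma> = B ** diag_mat \<gamma> ** B\<^sup>\<dagger> + \<rho> *\<^sub>R mat 1"

text \<open>Where \<open>\<gamma> $ i = 0\<close> the intended penalty on a nonzero
  \<open>c $ i\<close> is infinite, but division by 0 yields 0. The constraint
  \<open>c $ i = 0\<close> is therefore carried as a separate hypothesis where it matters.\<close>

definition primal ::
  "complex ^ 'g ^ 'm \<Rightarrow> complex ^ 'm \<Rightarrow> real \<Rightarrow> real ^ 'g \<Rightarrow> complex ^ 'g \<Rightarrow> real"
  where "primal B x \<rho> \<gamma> c =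
    (norm (x - B *v c))\<^sup>2 / \<rho> + (\<Sum>i\<in>UNIV. (norm (c $ i))\<^sup>2 / \<gamma> $ i)"

text \<open>The Lagrange dual of \<open>primal\<close>: concave in \<open>y\<close> for
  \<open>\<gamma>\<close> in the orthant and \<open>\<rho> > 0\<close>, and affine in
  \<open>\<gamma>\<close> for fixed \<open>y\<close>.\<close>

definition dual ::
  "complex ^ 'g ^ 'm \<Rightarrow> complex ^ 'm \<Rightarrow> real \<Rightarrow> real ^ 'g \<Rightarrow> complex ^ 'm \<Rightarrow> real"
  where "dual B x \<rho> \<gamma> y =
    2 * (y \<bullet> x) - (\<Sum>i\<in>UNIV. \<gamma> $ i * (norm ((B\<^sup>\<dagger> *v y) $ i))\<^sup>2) - \<rho> * (norm y)\<^sup>2"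

text \<open>The stationary point of \<open>dual\<close>: setting the gradient in \<open>y\<close> to
  zero gives the linear system \<open>regularized_gram B \<rho> \<gamma> *v y = x\<close>.\<close>

definition dual_opt ::
  "complex ^ 'g ^ 'm \<Rightarrow> complex ^ 'm \<Rightarrow> real \<Rightarrow> real ^ 'g \<Rightarrow> complex ^ 'm"
  where "dual_opt B x \<rho> \<gamma> = matrix_inv (regularized_gram B \<rho> \<gamma>) *v x"

text \<open>The equality case \<open>c = r *\<^sub>R u\<close> of Young's inequality in each
  coordinate, with \<open>r = \<gamma> $ i\<close> and \<open>u\<close> the coordinate of
  \<open>B\<^sup>\<dagger> *v y\<close> at the optimal \<open>y\<close>.\<close>

definition primal_opt ::
  "complex ^ 'g ^ 'm \<Rightarrow> complex ^ 'm \<Rightarrow> real \<Rightarrow> real ^ 'g \<Rightarrow> complex ^ 'g"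
  where "primal_opt B x \<rho> \<gamma> = diag_mat \<gamma> *v (B\<^sup>\<dagger> *v dual_opt B x \<rho> \<gamma>)"

text \<open>Split \<open>x\<close> into the residual \<open>x - B *v c\<close> and the fit
  \<open>B *v c\<close>. Young's inequality with weight \<open>\<rho>\<close> bounds the first part,
  and with weights \<open>\<gamma> $ i\<close>, coordinate by coordinate, the second.\<close>

lemma weak_duality:
  assumes "\<rho> > 0" "\<gamma> \<in> nonneg_orthant" "\<And>i. \<gamma> $ i = 0 \<Longrightarrow> c $ i = 0"
  shows "dual B x \<rho> \<gamma> y \<le> primal B x \<rho> \<gamma> c"
proof -
  have "2 * (y \<bullet> x) = 2 * (y \<bullet> (x - B *v c)) + 2 * ((B\<^sup>\<dagger> *v y) \<bullet> c)"
    using inner_matrix_vector_adjoint[of B c y] by (simp add: inner_diff_right inner_commute)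
  also have "2 * (y \<bullet> (x - B *v c)) \<le> \<rho> * (norm y)\<^sup>2 + (norm (x - B *v c))\<^sup>2 / \<rho>"
    by (rule weighted_Young) (use assms in auto)
  also have "2 * ((B\<^sup>\<dagger> *v y) \<bullet> c) \<le> (\<Sum>i\<in>UNIV. \<gamma> $ i * (norm ((B\<^sup>\<dagger> *v y) $ i))\<^sup>2)
      + (\<Sum>i\<in>UNIV. (norm (c $ i))\<^sup>2 / \<gamma> $ i)"
    unfolding inner_vec_def sum_distrib_left sum.distrib[symmetric]
    by (intro sum_mono weighted_Young) (use assms in \<open>auto simp: nonneg_orthant_def\<close>)
  finally show ?thesis by (simp add: primal_def dual_def)
qed

lemma regularized_gram_mult:
  "regularized_gram B \<rho> \<gamma> *v y = B *v (diag_mat \<gamma> *v (B\<^sup>\<dagger> *v y)) + \<rho> *\<^sub>R y"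
  by (simp add: regularized_gram_def matrix_vector_mult_add_rdistrib scaleR_mat_1_mult
      matrix_vector_mul_assoc matrix_mul_assoc)

text \<open>Identifies the quadratic part of \<open>dual\<close>; for \<open>\<rho> > 0\<close> and
  \<open>\<gamma>\<close> in the orthant it also shows that the matrix is positive definite.\<close>

lemma inner_regularized_gram:
  "y \<bullet> (regularized_gram B \<rho> \<gamma> *v y)
    = (\<Sum>i\<in>UNIV. \<gamma> $ i * (norm ((B\<^sup>\<dagger> *v y) $ i))\<^sup>2) + \<rho> * (norm y)\<^sup>2"
proof -
  have "y \<bullet> (regularized_gram B \<rho> \<gamma> *v y)
      = (diag_mat \<gamma> *v (B\<^sup>\<dagger> *v y)) \<bullet> (B\<^sup>\<dagger> *v y) + \<rho> * (norm y)\<^sup>2"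
    by (simp add: regularized_gram_mult inner_add_right inner_commute[of y "B *v _"]
        inner_matrix_vector_adjoint power2_norm_eq_inner)
  then show ?thesis
    by (simp add: inner_vec_def[of "diag_mat \<gamma> *v _"] diag_mat_mult_nth power2_norm_eq_inner)
qed

lemma regularized_gram_mult_dual_opt:
  assumes "\<rho> > 0" "\<gamma> \<in> nonneg_orthant"
  shows "regularized_gram B \<rho> \<gamma> *v dual_opt B x \<rho> \<gamma> = x"
proof -
  let ?M = "regularized_gram B \<rho> \<gamma>"
  have "y = 0" if "?M *v y = 0" for y
  proof -
    have "0 \<le> (\<Sum>i\<in>UNIV. \<gamma> $ i * (norm ((B\<^sup>\<dagger> *v y) $ i))\<^sup>2)"
      using assms by (intro sum_nonneg) (auto simp: nonneg_orthant_def)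
    moreover have "\<dots> + \<rho> * (norm y)\<^sup>2 = 0"
      using inner_regularized_gram[of y B \<rho> \<gamma>] that by simp
    moreover have "0 \<le> \<rho> * (norm y)\<^sup>2" using assms by simp
    ultimately have "\<rho> * (norm y)\<^sup>2 = 0" by linarith
    then show "y = 0" using assms by simp
  qed
  then have "invertible ?M"
    by (simp add: invertible_left_inverse matrix_left_invertible_ker)
  \<comment> \<open>\<open>matrix_inv\<close> is a choice among two-sided inverses, so invertibility
    supplies the witness.\<close>
  then have "?M ** matrix_inv ?M = mat 1"
    unfolding invertible_def matrix_inv_def by (rule someI2_ex) blast
  then show ?thesis by (simp add: dual_opt_def matrix_vector_mul_assoc)
qed

text \<open>At the stationary point the quadratic part equals \<open>y \<bullet> x\<close>, which
  leaves one of the two copies of the linear term.\<close>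

lemma dual_dual_opt:
  assumes "\<rho> > 0" "\<gamma> \<in> nonneg_orthant"
  shows "dual B x \<rho> \<gamma> (dual_opt B x \<rho> \<gamma>) = x \<bullet> dual_opt B x \<rho> \<gamma>"
  using inner_regularized_gram[of "dual_opt B x \<rho> \<gamma>" B \<rho> \<gamma>]
  by (simp add: dual_def regularized_gram_mult_dual_opt[OF assms] inner_commute)

text \<open>Strong duality: this is also the dual value at \<open>dual_opt\<close>. The two terms of
  \<open>primal\<close> become the two terms of the quadratic form of
  \<open>regularized_gram\<close>.\<close>

lemma primal_primal_opt:
  assumes "\<rho> > 0" "\<gamma> \<in> nonneg_orthant"
  shows "primal B x \<rho> \<gamma> (primal_opt B x \<rho> \<gamma>) = x \<bullet> dual_opt B x \<rho> \<gamma>"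
proof -
  let ?y = "dual_opt B x \<rho> \<gamma>"
  \<comment> \<open>The linear system for \<open>?y\<close> with \<open>primal_opt\<close>
    recognized in it: the residual is \<open>\<rho>\<close> times the dual point.\<close>
  have x: "x = B *v primal_opt B x \<rho> \<gamma> + \<rho> *\<^sub>R ?y"
    using regularized_gram_mult_dual_opt[OF assms, of B x]
    by (simp add: regularized_gram_mult primal_opt_def)
  have "x - B *v primal_opt B x \<rho> \<gamma> = \<rho> *\<^sub>R ?y"
    by (subst x) simp
  then have "(norm (x - B *v primal_opt B x \<rho> \<gamma>))\<^sup>2 / \<rho> = \<rho> * (norm ?y)\<^sup>2"
    using assms by (simp add: power2_eq_square)
  moreover have "(norm (primal_opt B x \<rho> \<gamma> $ i))\<^sup>2 / \<gamma> $ i = \<gamma> $ i * (norm ((B\<^sup>\<dagger> *v ?y) $ i))\<^sup>2" for i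
    by (cases "\<gamma> $ i = 0")
      (simp_all add: primal_opt_def diag_mat_mult_nth power_mult_distrib power2_eq_square[of "\<gamma> $ i"])
  moreover have "x \<bullet> ?y = ?y \<bullet> (regularized_gram B \<rho> \<gamma> *v ?y)"
    by (simp add: regularized_gram_mult_dual_opt[OF assms] inner_commute)
  ultimately show ?thesis
    by (simp add: primal_def inner_regularized_gram)
qed

lemma primal_opt_eq_0: "\<gamma> $ i = 0 \<Longrightarrow> primal_opt B x \<rho> \<gamma> $ i = 0"
  by (simp add: primal_opt_def diag_mat_mult_nth)

section \<open>The joint objective\<close>

definition joint_obj ::
  "('t::finite \<Rightarrow> complex ^ 'g ^ 'm) \<Rightarrow> ('t \<Rightarrow> complex ^ 'm) \<Rightarrow> real
    \<Rightarrow> complex ^ 't ^ 'g \<Rightarrow> real ^ 'g \<Rightarrow> real"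
  where "joint_obj B x \<rho> C \<gamma> =
    (\<Sum>s\<in>UNIV. primal (B s) (x s) \<rho> \<gamma> (column s C)) + real CARD('t) * (\<Sum>i\<in>UNIV. \<gamma> $ i)"

section \<open>Minimization over \<open>C\<close> for fixed \<open>\<gamma>\<close>\<close>

lemma g_obj_eq:
  fixes \<Psi> :: "'t::finite \<Rightarrow> complex ^ 'n ^ 'm" and A :: "complex ^ 'g ^ 'n"
  shows "real CARD('t) * g_obj \<Psi> A x \<rho> \<gamma> =
    (\<Sum>s\<in>UNIV. x s \<bullet> dual_opt (\<Psi> s ** A) (x s) \<rho> \<gamma>) + real CARD('t) * (\<Sum>i\<in>UNIV. \<gamma> $ i)"
proof -
  have "Re (trace (diag_mat \<gamma>)) = (\<Sum>i\<in>UNIV. \<gamma> $ i)"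
    by (simp add: trace_def diag_mat_def)
  then show ?thesis
    by (simp add: g_obj_def Re_sesq_form dual_opt_def regularized_gram_def conj_transpose_mult
        matrix_mul_assoc algebra_simps)
qed

text \<open>Weak duality for each sample, taken at the optimal dual point, whose dual value is the
  quadratic term of \<open>g_obj\<close>.\<close>

lemma g_obj_le_joint_obj:
  fixes \<Psi> :: "'t::finite \<Rightarrow> complex ^ 'n ^ 'm" and A :: "complex ^ 'g ^ 'n"
  assumes "\<rho> > 0" "\<gamma> \<in> nonneg_orthant" "\<And>i. \<gamma> $ i = 0 \<Longrightarrow> row i C = 0"
  shows "real CARD('t) * g_obj \<Psi> A x \<rho> \<gamma> \<le> joint_obj (\<lambda>s. \<Psi> s ** A) x \<rho> C \<gamma>"
proof -
  have "x s \<bullet> dual_opt (\<Psi> s ** A) (x s) \<rho> \<gamma> \<le> primal (\<Psi> s ** A) (x s) \<rho> \<gamma> (column s C)" for s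
    unfolding dual_dual_opt[OF assms(1,2), symmetric]
    by (rule weak_duality[OF assms(1,2)])
      (use assms(3) in \<open>simp add: column_def row_def vec_eq_iff\<close>)
  then show ?thesis
    unfolding g_obj_eq joint_obj_def by (simp add: sum_mono)
qed

text \<open>For fixed \<open>\<gamma>\<close> the samples decouple, so the optimal ridge
  coefficients of the samples can be assembled as the columns of one matrix.\<close>

lemma g_obj_eq_joint_obj:
  fixes \<Psi> :: "'t::finite \<Rightarrow> complex ^ 'n ^ 'm" and A :: "complex ^ 'g ^ 'n"
  assumes "\<rho> > 0" "\<gamma> \<in> nonneg_orthant"
  obtains C where "\<And>i. \<gamma> $ i = 0 \<Longrightarrow> row i C = 0"
    and "real CARD('t) * g_obj \<Psi> A x \<rho> \<gamma> = joint_obj (\<lambda>s. \<Psi> s ** A) x \<rho> C \<gamma>"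
proof
  let ?C = "\<chi> i s. primal_opt (\<Psi> s ** A) (x s) \<rho> \<gamma> $ i"
  show "row i ?C = 0" if "\<gamma> $ i = 0" for i
    using that by (simp add: row_def vec_eq_iff primal_opt_eq_0)
  have "column s ?C = primal_opt (\<Psi> s ** A) (x s) \<rho> \<gamma>" for s
    by (simp add: column_def)
  then show "real CARD('t) * g_obj \<Psi> A x \<rho> \<gamma> = joint_obj (\<lambda>s. \<Psi> s ** A) x \<rho> ?C \<gamma>"
    unfolding g_obj_eq joint_obj_def by (simp add: primal_primal_opt[OF assms])
qed

section \<open>Minimization over \<open>\<gamma>\<close> for fixed \<open>C\<close>\<close>

lemma joint_obj_eq:
  fixes \<Psi> :: "'t::finite \<Rightarrow> complex ^ 'n ^ 'm" and A :: "complex ^ 'g ^ 'n"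
  assumes "\<rho> > 0"
  shows "joint_obj (\<lambda>s. \<Psi> s ** A) x \<rho> C \<gamma> = 2 / \<rho> * f_obj \<Psi> A x \<rho> C
    + (\<Sum>i\<in>UNIV. (norm (row i C))\<^sup>2 / \<gamma> $ i + real CARD('t) * \<gamma> $ i
        - 2 * sqrt (real CARD('t)) * norm (row i C))"
proof -
  \<comment> \<open>All samples share the weights \<open>\<gamma>\<close>, so exchanging the sums
    collects the entries into rows. This is where the row norms of \<open>norm21\<close> come
    from.\<close>
  have "(\<Sum>s\<in>UNIV. \<Sum>i\<in>UNIV. (norm (C $ i $ s))\<^sup>2 / \<gamma> $ i)
      = (\<Sum>i\<in>UNIV. (norm (row i C))\<^sup>2 / \<gamma> $ i)"
    by (subst sum.swap)
      (simp add: norm_vec_def L2_set_def row_def sum_nonneg sum_divide_distrib)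
  then show ?thesis using assms
    by (simp add: joint_obj_def primal_def f_obj_def norm21_def column_def sum.distrib
        sum_subtractf sum_divide_distrib[symmetric] sum_distrib_left[symmetric]
        sum_distrib_right[symmetric] field_simps)
qed

text \<open>The gap is the square of \<open>b - sqrt t * r\<close> divided by \<open>r\<close>. For
  \<open>r = 0\<close> the hypothesis forces \<open>b = 0\<close>, and both sides of the equivalence
  hold.\<close>

lemma AM_GM_gap:
  fixes b r t :: real
  assumes "t > 0" "r \<ge> 0" "r = 0 \<Longrightarrow> b = 0"
  shows "b\<^sup>2 / r + t * r - 2 * sqrt t * b \<ge> 0"
    and "b\<^sup>2 / r + t * r - 2 * sqrt t * b = 0 \<longleftrightarrow> r = b / sqrt t"
proof -
  have "b\<^sup>2 / r + t * r - 2 * sqrt t * b = (b - sqrt t * r)\<^sup>2 / r"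
  proof (cases "r = 0")
    case False
    have "(b - sqrt t * r)\<^sup>2 = b\<^sup>2 + t * r\<^sup>2 - 2 * sqrt t * b * r"
      using assms by (simp add: power2_diff power_mult_distrib)
    then show ?thesis using False by (simp add: field_simps power2_eq_square)
  qed (use assms in simp)
  then show "b\<^sup>2 / r + t * r - 2 * sqrt t * b \<ge> 0"
    "b\<^sup>2 / r + t * r - 2 * sqrt t * b = 0 \<longleftrightarrow> r = b / sqrt t"
    using assms by (auto simp: field_simps)
qed

text \<open>The difference is a sum of nonnegative gaps, one per row, so it vanishes only if every
  gap does. This equality case is what later identifies \<open>\<gamma>\<close>.\<close>

lemma f_obj_le_joint_obj:
  fixes \<Psi> :: "'t::finite \<Rightarrow> complex ^ 'n ^ 'm" and A :: "complex ^ 'g ^ 'n"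
  assumes "\<rho> > 0" "\<gamma> \<in> nonneg_orthant" "\<And>i. \<gamma> $ i = 0 \<Longrightarrow> row i C = 0"
  shows "2 / \<rho> * f_obj \<Psi> A x \<rho> C \<le> joint_obj (\<lambda>s. \<Psi> s ** A) x \<rho> C \<gamma>"
    and "2 / \<rho> * f_obj \<Psi> A x \<rho> C = joint_obj (\<lambda>s. \<Psi> s ** A) x \<rho> C \<gamma>
      \<longleftrightarrow> (\<forall>i. \<gamma> $ i = norm (row i C) / sqrt (real CARD('t)))"
proof -
  let ?gap = "\<lambda>i. (norm (row i C))\<^sup>2 / \<gamma> $ i + real CARD('t) * \<gamma> $ i
    - 2 * sqrt (real CARD('t)) * norm (row i C)"
  have gap: "?gap i \<ge> 0" "?gap i = 0 \<longleftrightarrow> \<gamma> $ i = norm (row i C) / sqrt (real CARD('t))" for i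
    by (rule AM_GM_gap; use assms in \<open>simp add: nonneg_orthant_def\<close>)+
  have "sum ?gap UNIV \<ge> 0" by (rule sum_nonneg) (rule gap)
  then show "2 / \<rho> * f_obj \<Psi> A x \<rho> C \<le> joint_obj (\<lambda>s. \<Psi> s ** A) x \<rho> C \<gamma>"
    unfolding joint_obj_eq[OF assms(1)] by linarith
  have "sum ?gap UNIV = 0 \<longleftrightarrow> (\<forall>i. ?gap i = 0)"
    using gap(1) by (subst sum_nonneg_eq_0_iff) auto
  then show "2 / \<rho> * f_obj \<Psi> A x \<rho> C = joint_obj (\<lambda>s. \<Psi> s ** A) x \<rho> C \<gamma>
      \<longleftrightarrow> (\<forall>i. \<gamma> $ i = norm (row i C) / sqrt (real CARD('t)))"
    unfolding joint_obj_eq[OF assms(1)] gap(2)[symmetric] by simp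
qed

section \<open>Convexity and existence of minimizers\<close>

lemma convex_on_power2_norm: "convex_on UNIV (\<lambda>v :: 'a :: real_normed_vector. (norm v)\<^sup>2)"
proof (rule convex_onI)
  fix t :: real and v w :: 'a
  assume t: "0 < t" "t < 1"
  have "norm ((1 - t) *\<^sub>R v + t *\<^sub>R w) \<le> (1 - t) * norm v + t * norm w"
    using t norm_triangle_ineq[of "(1 - t) *\<^sub>R v" "t *\<^sub>R w"] by simp
  then have "(norm ((1 - t) *\<^sub>R v + t *\<^sub>R w))\<^sup>2 \<le> ((1 - t) * norm v + t * norm w)\<^sup>2"
    by (rule power_mono) simp
  also have "\<dots> \<le> (1 - t) * (norm v)\<^sup>2 + t * (norm w)\<^sup>2"
    using convex_onD[OF convex_power2, of t "norm v" "norm w"] t by simp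
  finally show "(norm ((1 - t) *\<^sub>R v + t *\<^sub>R w))\<^sup>2 \<le> (1 - t) * (norm v)\<^sup>2 + t * (norm w)\<^sup>2" .
qed simp

lemma matrix_vector_mult_scaleR: "(M :: complex ^ 'q ^ 'p) *v (r *\<^sub>R v) = r *\<^sub>R (M *v v)"
  by (simp add: vec_eq_iff matrix_vector_mult_def scaleR_sum_right)

lemma convex_on_f_obj:
  fixes \<Psi> :: "'t::finite \<Rightarrow> complex ^ 'n ^ 'm" and A :: "complex ^ 'g ^ 'n"
  assumes "\<rho> \<ge> 0"
  shows "convex_on UNIV (f_obj \<Psi> A x \<rho>)"
proof (rule convex_onI)
  fix t :: real and C D :: "complex ^ 't ^ 'g"
  assume t: "0 < t" "t < 1"
  let ?E = "(1 - t) *\<^sub>R C + t *\<^sub>R D"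
  let ?r = "\<lambda>C s. x s - (\<Psi> s ** A) *v column s C"
  have "?r ?E s = (1 - t) *\<^sub>R ?r C s + t *\<^sub>R ?r D s" for s
  proof -
    have "column s ?E = (1 - t) *\<^sub>R column s C + t *\<^sub>R column s D"
      by (simp add: column_def vec_eq_iff)
    then show ?thesis
      by (simp only: matrix_vector_right_distrib matrix_vector_mult_scaleR)
        (simp add: algebra_simps)
  qed
  then have "(\<Sum>s\<in>UNIV. (norm (?r ?E s))\<^sup>2)
      \<le> (\<Sum>s\<in>UNIV. (1 - t) * (norm (?r C s))\<^sup>2 + t * (norm (?r D s))\<^sup>2)"
    using t by (intro sum_mono) (simp add: convex_onD[OF convex_on_power2_norm])
  then have "1 / 2 * (\<Sum>s\<in>UNIV. (norm (?r ?E s))\<^sup>2)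
      \<le> (1 - t) * (1 / 2 * (\<Sum>s\<in>UNIV. (norm (?r C s))\<^sup>2))
        + t * (1 / 2 * (\<Sum>s\<in>UNIV. (norm (?r D s))\<^sup>2))"
    by (simp add: sum.distrib sum_distrib_left[symmetric])
  moreover have "norm21 ?E \<le> (1 - t) * norm21 C + t * norm21 D"
  proof -
    have "norm (row i ?E) \<le> (1 - t) * norm (row i C) + t * norm (row i D)" for i
    proof -
      have "row i ?E = (1 - t) *\<^sub>R row i C + t *\<^sub>R row i D"
        by (simp add: row_def vec_eq_iff)
      then show ?thesis
        using t norm_triangle_ineq[of "(1 - t) *\<^sub>R row i C" "t *\<^sub>R row i D"] by simp
    qed
    then show ?thesis
      unfolding norm21_def sum_distrib_left sum.distrib[symmetric] by (intro sum_mono)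
  qed
  then have "\<rho> * sqrt (real CARD('t)) * norm21 ?E
      \<le> \<rho> * sqrt (real CARD('t)) * ((1 - t) * norm21 C + t * norm21 D)"
    using assms by (intro mult_left_mono) auto
  ultimately show "f_obj \<Psi> A x \<rho> ?E \<le> (1 - t) * f_obj \<Psi> A x \<rho> C + t * f_obj \<Psi> A x \<rho> D"
    unfolding f_obj_def
    by (rule order_trans[OF add_mono]) (simp add: ring_distribs mult.left_commute)
qed simp

lemma convex_nonneg_orthant: "convex (nonneg_orthant :: (real ^ 'g) set)"
  by (auto simp: convex_def nonneg_orthant_def)

lemma convex_on_g_obj:
  fixes \<Psi> :: "'t::finite \<Rightarrow> complex ^ 'n ^ 'm" and A :: "complex ^ 'g ^ 'n"
  assumes "\<rho> > 0"
  shows "convex_on nonneg_orthant (g_obj \<Psi> A x \<rho>)"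
proof (rule convex_onI)
  fix t :: real and \<gamma> \<delta> :: "real ^ 'g"
  assume t: "0 < t" "t < 1" and \<gamma>: "\<gamma> \<in> nonneg_orthant" and \<delta>: "\<delta> \<in> nonneg_orthant"
  let ?\<epsilon> = "(1 - t) *\<^sub>R \<gamma> + t *\<^sub>R \<delta>"
  let ?B = "\<lambda>s. \<Psi> s ** A"
  let ?q = "\<lambda>\<gamma> s. x s \<bullet> dual_opt (?B s) (x s) \<rho> \<gamma>"
  have \<epsilon>: "?\<epsilon> \<in> nonneg_orthant"
    using t by (intro convexD[OF convex_nonneg_orthant] \<gamma> \<delta>) auto
  \<comment> \<open>By strong duality \<open>?q \<gamma> s\<close> is a primal value, so it
    dominates every dual value.\<close>
  have dual_le: "dual (?B s) (x s) \<rho> \<gamma> y \<le> ?q \<gamma> s" if "\<gamma> \<in> nonneg_orthant" for \<gamma> s y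
    unfolding primal_primal_opt[OF assms that, symmetric]
    by (rule weak_duality[OF assms that primal_opt_eq_0])
  have "?q ?\<epsilon> s \<le> (1 - t) * ?q \<gamma> s + t * ?q \<delta> s" for s
  proof -
    \<comment> \<open>The dual point optimal for the intermediate weights is kept fixed and used as
      a competitor at both endpoints, so that \<open>dual\<close> is affine along the
      segment.\<close>
    let ?y = "dual_opt (?B s) (x s) \<rho> ?\<epsilon>"
    have "?q ?\<epsilon> s = dual (?B s) (x s) \<rho> ?\<epsilon> ?y"
      by (simp add: dual_dual_opt[OF assms \<epsilon>])
    also have "\<dots> = (1 - t) * dual (?B s) (x s) \<rho> \<gamma> ?y + t * dual (?B s) (x s) \<rho> \<delta> ?y"
      unfolding dual_def
      by (simp add: algebra_simps sum.distrib sum_subtractf sum_distrib_left)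
    also have "\<dots> \<le> (1 - t) * ?q \<gamma> s + t * ?q \<delta> s"
      using t by (intro add_mono mult_left_mono dual_le \<gamma> \<delta>) auto
    finally show ?thesis .
  qed
  then have "sum (?q ?\<epsilon>) UNIV \<le> (1 - t) * sum (?q \<gamma>) UNIV + t * sum (?q \<delta>) UNIV"
    unfolding sum_distrib_left sum.distrib[symmetric] by (rule sum_mono)
  then have "real CARD('t) * g_obj \<Psi> A x \<rho> ?\<epsilon>
      \<le> real CARD('t) * ((1 - t) * g_obj \<Psi> A x \<rho> \<gamma> + t * g_obj \<Psi> A x \<rho> \<delta>)"
    unfolding distrib_left mult.left_commute[of "real CARD('t)"] g_obj_eq
    by (simp add: algebra_simps sum.distrib sum_subtractf sum_distrib_left)
  then show "g_obj \<Psi> A x \<rho> ?\<epsilon> \<le> (1 - t) * g_obj \<Psi> A x \<rho> \<gamma> + t * g_obj \<Psi> A x \<rho> \<delta>"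
    by simp
qed (rule convex_nonneg_orthant)

text \<open>The penalty makes \<open>f_obj\<close> grow at least like
  \<open>\<rho> * norm C\<close>. Outside the ball of radius
  \<open>f_obj \<Psi> A x \<rho> 0 / \<rho>\<close> its values exceed the value at 0, and on the
  ball compactness gives a minimizer.\<close>

lemma f_obj_attains_min:
  fixes \<Psi> :: "'t::finite \<Rightarrow> complex ^ 'n ^ 'm" and A :: "complex ^ 'g ^ 'n"
  assumes "\<rho> > 0"
  obtains C where "\<And>D. f_obj \<Psi> A x \<rho> C \<le> f_obj \<Psi> A x \<rho> D"
proof -
  let ?f = "f_obj \<Psi> A x \<rho>"
  let ?K = "cball 0 (?f 0 / \<rho>) :: (complex ^ 't ^ 'g) set"
  have coercive: "\<rho> * norm C \<le> ?f C" for C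
  proof -
    have "norm C \<le> norm21 C"
      unfolding norm_vec_def[of C] norm21_def by (simp add: row_def L2_set_le_sum)
    \<comment> \<open>Index types are nonempty, so \<open>sqrt (real CARD('t))\<close> is at least
      1.\<close>
    also have "\<dots> \<le> sqrt (real CARD('t)) * norm21 C"
      using mult_right_mono[of 1 "sqrt (real CARD('t))" "norm21 C"]
      by (simp add: norm21_def sum_nonneg Suc_leI)
    finally have "\<rho> * norm C \<le> \<rho> * sqrt (real CARD('t)) * norm21 C" using assms by simp
    also have "\<dots> \<le> ?f C" unfolding f_obj_def by (simp add: sum_nonneg)
    finally show ?thesis .
  qed
  \<comment> \<open>Coercivity at 0 says that the value there, hence the radius, is
    nonnegative.\<close>
  have "0 \<in> ?K" using coercive[of 0] assms by simp
  moreover have "continuous_on ?K ?f"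
    unfolding f_obj_def norm21_def row_def column_def matrix_vector_mult_def
    by (intro continuous_intros)
  ultimately obtain C where C: "\<And>D. D \<in> ?K \<Longrightarrow> ?f C \<le> ?f D"
    using continuous_attains_inf[of ?K ?f] compact_cball by blast
  have "?f C \<le> ?f D" for D
  proof (cases "D \<in> ?K")
    case False
    then have "?f 0 < \<rho> * norm D" using assms by (simp add: field_simps)
    then show ?thesis using coercive[of D] C[OF \<open>0 \<in> ?K\<close>] by linarith
  qed (rule C)
  then show ?thesis by (rule that)
qed

section \<open>Correspondence of the minimizers\<close>

text \<open>Neither objective need be strictly convex, so minimizers need not be unique. The formula
  is therefore stated as a correspondence in both directions, together with convexity and
  existence.\<close>

theorem theorem1:
  fixes \<Xi> :: "'l set" and a :: "'l \<Rightarrow> complex ^ 'n"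
    and k :: nat and \<xi> :: "nat \<Rightarrow> 'l" and w :: "nat \<Rightarrow> 't::finite \<Rightarrow> complex"
    and grid :: "'g::finite \<Rightarrow> 'l" and A :: "complex ^ 'g ^ 'n"
    and \<Psi> :: "'t \<Rightarrow> complex ^ 'n ^ 'm"
    and h :: "'t \<Rightarrow> complex ^ 'n" and z x :: "'t \<Rightarrow> complex ^ 'm"
    and \<rho> :: real
  assumes "\<rho> > 0"
    and "\<forall>s. \<Psi> s ** (\<Psi> s)\<^sup>\<dagger> = mat 1"
    and "\<forall>j. grid j \<in> \<Xi>"
    and "\<forall>j. column j A = a (grid j)"
    and "\<forall>i\<in>{1..k}. \<xi> i \<in> \<Xi>"
    and "\<forall>s. h s = (\<Sum>i=1..k. w i s *s a (\<xi> i))"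
    and "\<forall>s. x s = \<Psi> s *v h s + z s"
  shows "convex_on UNIV (f_obj \<Psi> A x \<rho>)
    \<and> convex_on nonneg_orthant (g_obj \<Psi> A x \<rho>)
    \<and> (\<exists>C. is_arg_min (f_obj \<Psi> A x \<rho>) (\<lambda>C. C \<in> UNIV) C)
    \<and> (\<exists>\<gamma>. is_arg_min (g_obj \<Psi> A x \<rho>) (\<lambda>\<gamma>. \<gamma> \<in> nonneg_orthant) \<gamma>)
    \<and> (\<forall>C. is_arg_min (f_obj \<Psi> A x \<rho>) (\<lambda>C. C \<in> UNIV) C \<longrightarrow>
          (\<exists>\<gamma>. is_arg_min (g_obj \<Psi> A x \<rho>) (\<lambda>\<gamma>. \<gamma> \<in> nonneg_orthant) \<gamma>
            \<and> (\<forall>i. \<gamma> $ i = norm (row i C) / sqrt (real CARD('t)))))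
    \<and> (\<forall>\<gamma>. is_arg_min (g_obj \<Psi> A x \<rho>) (\<lambda>\<gamma>. \<gamma> \<in> nonneg_orthant) \<gamma> \<longrightarrow>
          (\<exists>C. is_arg_min (f_obj \<Psi> A x \<rho>) (\<lambda>C. C \<in> UNIV) C
            \<and> (\<forall>i. \<gamma> $ i = norm (row i C) / sqrt (real CARD('t)))))"
proof (intro conjI allI impI)
  let ?f = "f_obj \<Psi> A x \<rho>" and ?g = "g_obj \<Psi> A x \<rho>"
  let ?J = "joint_obj (\<lambda>s. \<Psi> s ** A) x \<rho>"
  let ?argf = "is_arg_min ?f (\<lambda>C. C \<in> UNIV)" and ?argg = "is_arg_min ?g (\<lambda>\<gamma>. \<gamma> \<in> nonneg_orthant)"
  define powers :: "complex ^ 't ^ 'g \<Rightarrow> real ^ 'g"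
    where "powers C = (\<chi> i. norm (row i C) / sqrt (real CARD('t)))" for C
  note \<rho> = \<open>\<rho> > 0\<close>
  have powers_nonneg: "powers C \<in> nonneg_orthant" for C
    by (simp add: powers_def nonneg_orthant_def)
  have powers_zero: "row i C = 0" if "powers C $ i = 0" for i C
    using that by (simp add: powers_def)
  have f_eq: "2 / \<rho> * ?f C = ?J C (powers C)" for C
    by (rule iffD2[OF f_obj_le_joint_obj(2)[OF \<rho> powers_nonneg powers_zero]])
      (simp_all add: powers_def)
  \<comment> \<open>Both sides are compared with \<open>?J C (powers C)\<close>: the left is its
    lower bound over coefficient matrices, the right is its exact value.\<close>
  have g_le: "real CARD('t) * ?g (powers C) \<le> 2 / \<rho> * ?f C" for C
    using g_obj_le_joint_obj[OF \<rho> powers_nonneg powers_zero] unfolding f_eq .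

  show "convex_on UNIV ?f" using \<rho> by (intro convex_on_f_obj) simp
  show "convex_on nonneg_orthant ?g" by (rule convex_on_g_obj[OF \<rho>])
  obtain C0 where C0: "?argf C0"
    using f_obj_attains_min[OF \<rho>, of \<Psi> A x] by (auto simp: is_arg_min_linorder)
  then show "\<exists>C. ?argf C" ..

  show f_to_g: "\<exists>\<gamma>. ?argg \<gamma> \<and> (\<forall>i. \<gamma> $ i = norm (row i C) / sqrt (real CARD('t)))"
    if C: "?argf C" for C
  proof (intro exI conjI allI)
    have "?g (powers C) \<le> ?g \<gamma>" if \<gamma>: "\<gamma> \<in> nonneg_orthant" for \<gamma>
    proof -
      \<comment> \<open>\<open>D\<close> is optimal for the competitor \<open>\<gamma>\<close>, so
        minimality of \<open>C\<close> against \<open>D\<close> can be carried over to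
        \<open>?g\<close>.\<close>
      obtain D where D: "\<And>i. \<gamma> $ i = 0 \<Longrightarrow> row i D = 0" "real CARD('t) * ?g \<gamma> = ?J D \<gamma>"
        using g_obj_eq_joint_obj[OF \<rho> \<gamma>, of \<Psi> A x] by blast
      have "real CARD('t) * ?g (powers C) \<le> 2 / \<rho> * ?f C" by (rule g_le)
      also have "\<dots> \<le> 2 / \<rho> * ?f D"
        using C \<rho> by (intro mult_left_mono) (auto simp: is_arg_min_linorder)
      also have "\<dots> \<le> real CARD('t) * ?g \<gamma>"
        unfolding D(2) by (rule f_obj_le_joint_obj(1)[OF \<rho> \<gamma> D(1)])
      finally show ?thesis by simp
    qed
    then show "?argg (powers C)" by (simp add: is_arg_min_linorder powers_nonneg)
    show "powers C $ i = norm (row i C) / sqrt (real CARD('t))" for i by (simp add: powers_def)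
  qed
  \<comment> \<open>Existence for \<open>?g\<close> is inherited from \<open>?f\<close>, without a
    separate compactness argument.\<close>
  show "\<exists>\<gamma>. ?argg \<gamma>" using f_to_g[OF C0] by blast

  show "\<exists>C. ?argf C \<and> (\<forall>i. \<gamma> $ i = norm (row i C) / sqrt (real CARD('t)))"
    if "?argg \<gamma>" for \<gamma>
  proof -
    have \<gamma>: "\<gamma> \<in> nonneg_orthant" and min: "\<And>\<delta>. \<delta> \<in> nonneg_orthant \<Longrightarrow> ?g \<gamma> \<le> ?g \<delta>"
      using that by (auto simp: is_arg_min_linorder)
    obtain C where C: "\<And>i. \<gamma> $ i = 0 \<Longrightarrow> row i C = 0" "real CARD('t) * ?g \<gamma> = ?J C \<gamma>"
      using g_obj_eq_joint_obj[OF \<rho> \<gamma>, of \<Psi> A x] by blast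
    have le: "?J C \<gamma> \<le> 2 / \<rho> * ?f D" for D
    proof -
      have "?J C \<gamma> \<le> real CARD('t) * ?g (powers D)"
        unfolding C(2)[symmetric] by (intro mult_left_mono min powers_nonneg) simp
      also have "\<dots> \<le> 2 / \<rho> * ?f D" by (rule g_le)
      finally show ?thesis .
    qed
    \<comment> \<open>Taking \<open>D = C\<close> in \<open>le\<close> closes the chain of
      inequalities. The resulting equality is the AM-GM equality case, which yields the formula for
      \<open>\<gamma>\<close>, and it turns \<open>le\<close> into minimality of
      \<open>C\<close>.\<close>
    have eq: "2 / \<rho> * ?f C = ?J C \<gamma>"
      using f_obj_le_joint_obj(1)[OF \<rho> \<gamma> C(1)] le[of C] by (rule antisym)
    have "?f C \<le> ?f D" for D
      using le[of D] \<rho> unfolding eq[symmetric] by (simp add: field_simps)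
    then have "?argf C" by (simp add: is_arg_min_linorder)
    moreover have "\<forall>i. \<gamma> $ i = norm (row i C) / sqrt (real CARD('t))"
      using eq f_obj_le_joint_obj(2)[OF \<rho> \<gamma> C(1)] by blast
    ultimately show ?thesis by blast
  qed
qed

end
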